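(* Let $\boldsymbol S\in\mathbb{SPD}^n$ be the matrix of an approximate dual basis to the B-splines $B_1,\dots,B_n$ of the spline space $\mathbb{S}^p_r$ on $[a,b]$, and let $\hat{\boldsymbol G}=[\hat G_{ij}]=\boldsymbol S^{-1}$. Suppose $f\in H^1([a,b])$ satisfies $f(a)=0$. Then the spline function $$u(x)=\sum_{i=2}^n\langle f,\hat B_i\rangle\,B_i(x),$$ where here $$\begin{bmatrix}\hat B_2(x)\\ \vdots\\ \hat B_n(x)\end{bmatrix}=\begin{bmatrix}\hat G_{22}&\cdots&\hat G_{2n}\\ \vdots&\ddots&\vdots\\ \hat G_{n2}&\cdots&\hat G_{nn}\end{bmatrix}^{-1}\begin{bmatrix}B_2(x)\\ \vdots\\ B_n(x)\end{bmatrix},$$ is the unique solution to the convex minimization problem $$\underset{u\in\mathbb{S}^p_r}{\operatorname{argmin}}\ \tfrac12\langle u,u\rangle_{\hat G}-\langle u,f\rangle\quad\text{subject to } u(a)=0.$$ Furthermore, if $f\in\mathbb{P}^p$, then $u=f$.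
   Context: Spline space. Let $a=x_0<x_1<\dots<x_\delta=b$ be a partition of $[a,b]$ into $\delta$ elements, let $p$ be the polynomial degree, and let $r=(r_1,\dots,r_{\delta-1})$ be integers with $0\le r_k\le p-1$. The knot vector $(t_i)_{i=1}^{n+p+1}$ is the nondecreasing sequence in which $x_0$ and $x_\delta$ are each repeated $p+1$ times and each interior breakpoint $x_k$ ($1\le k\le\delta-1$) is repeated $p-r_k$ times. The B-splines $B_i=B_{i,p}$, $i=1,\dots,n$, are defined by the Cox–de Boor recursion: $B_{i,0}(x)=1$ if $x\in[t_i,t_{i+1})$ and $0$ otherwise, and $$B_{i,p}(x)=\frac{x-t_i}{t_{i+p}-t_i}B_{i,p-1}(x)+\frac{t_{i+p+1}-x}{t_{i+p+1}-t_{i+1}}B_{i+1,p-1}(x),$$ with the convention $0/0=0$, and with the usual convention that the last nonempty knot interval is closed at $b$. The spline space is $\mathbb{S}^p_r=\operatorname{span}(B_1,\dots,B_n)$; it is the space of piecewise polynomials of degree $p$ having $r_k$ continuous derivatives at $x_k$, has dimension $n$, and contains the space $\mathbb{P}^p$ of polynomials of degree $<p+1$ on $[a,b]$. Inner product and dual basis. $\langle\cdot,\cdot\rangle$ is the standard $L^2([a,b])$ inner product. The Grammian matrix is $\boldsymbol G=[G_{ij}]$, $G_{ij}=\langle B_i,B_j\rangle$. The $L^2$ dual basis functions in $\mathbb{S}^p_r$ are $\tilde B_i=\sum_{j=1}^n(\boldsymbol G^{-1})_{ij}B_j$, so that $\langle\tilde B_i,B_j\rangle=\delta_{ij}$. Approximate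 dual basis. $\mathbb{SPD}^n$ is the set of symmetric positive definite real $n\times n$ matrices. A matrix $\boldsymbol S\in\mathbb{SPD}^n$ is the matrix of an approximate dual basis to the B-splines if the functions $\sum_{j=1}^nS_{ij}B_j$, $i=1,\dots,n$, satisfy $\langle g,\sum_{j=1}^nS_{ij}B_j\rangle=\langle g,\tilde B_i\rangle$ for all $g\in\mathbb{P}^p$ and all $i=1,\dots,n$. (The functions $\hat B_2,\dots,\hat B_n$ in the claim are those defined there by the inverse of the submatrix of $\hat{\boldsymbol G}$, and are in general different from these functions.) Discrete inner product. For $\hat{\boldsymbol G}\in\mathbb{SPD}^n$ and $u=\sum_iu_iB_i$, $v=\sum_iv_iB_i$ in $\mathbb{S}^p_r$, set $\langle u,v\rangle_{\hat G}:=\sum_{i=1}^n\sum_{j=1}^nu_i\hat G_{ij}v_j$. For $f\in H^1([a,b])$, the value $f(a)$ is that of the continuous representative. *)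

theory Defs
  imports
    "HOL-Analysis.Analysis"
    "Jordan_Normal_Form.Determinant"
    "Jordan_Normal_Form.Gauss_Jordan_Elimination"
    "HOL-Computational_Algebra.Polynomial"
begin

text \<open>
  All indices of knots, B-splines, vectors and matrices start at 0, as is usual for lists and for
  the matrix library. The B-splines \<open>B\<^sub>1, \<dots>, B\<^sub>n\<close> are thus \<open>B 0, \<dots>, B (n - 1)\<close>.
\<close>

section \<open>B-splines\<close>

definition knots :: "nat \<Rightarrow> nat \<Rightarrow> (nat \<Rightarrow> real) \<Rightarrow> (nat \<Rightarrow> nat) \<Rightarrow> real list" where
  "knots p \<delta> x r =
     replicate (p + 1) (x 0)
     @ concat (map (\<lambda>k. replicate (p - r k) (x k)) [1..<\<delta>])
     @ replicate (p + 1) (x \<delta>)"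

text \<open>
  The argument \<open>b\<close> is the right end point of the interval: a nonempty knot interval ending in \<open>b\<close>
  is closed. In the recursion, a denominator can only vanish together with the B-spline that the
  fraction multiplies, so that division by zero being zero gives the convention \<open>0/0 = 0\<close>.
\<close>

fun bspline :: "(nat \<Rightarrow> real) \<Rightarrow> real \<Rightarrow> nat \<Rightarrow> nat \<Rightarrow> real \<Rightarrow> real" where
  "bspline t b 0 i y =
     (if (t i \<le> y \<and> y < t (i + 1)) \<or> (t i < t (i + 1) \<and> t (i + 1) = b \<and> y = b) then 1 else 0)"
| "bspline t b (Suc q) i y =
     (y - t i) / (t (i + Suc q) - t i) * bspline t b q i y
     + (t (i + Suc q + 1) - y) / (t (i + Suc q + 1) - t (i + 1)) * bspline t b q (i + 1) y"

definition spline_space :: "nat \<Rightarrow> (nat \<Rightarrow> real \<Rightarrow> real) \<Rightarrow> (real \<Rightarrow> real) set" where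
  "spline_space n B = {u. \<exists>c. u = (\<lambda>y. \<Sum>i<n. c i * B i y)}"

definition coords :: "nat \<Rightarrow> (nat \<Rightarrow> real \<Rightarrow> real) \<Rightarrow> (real \<Rightarrow> real) \<Rightarrow> real vec" where
  "coords n B u =
     (THE c. c \<in> carrier_vec n \<and> u = (\<lambda>y. \<Sum>i<n. vec_index c i * B i y))"

definition poly_space :: "nat \<Rightarrow> real \<Rightarrow> real \<Rightarrow> (real \<Rightarrow> real) set" where
  "poly_space p a b = {g. \<exists>q. degree q \<le> p \<and> (\<forall>y\<in>{a..b}. g y = poly q y)}"

section \<open>Function spaces on an interval\<close>

definition L2_inner :: "real \<Rightarrow> real \<Rightarrow> (real \<Rightarrow> real) \<Rightarrow> (real \<Rightarrow> real) \<Rightarrow> real" where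
  "L2_inner a b f g = integral\<^sup>L (lebesgue_on {a..b}) (\<lambda>y. f y * g y)"

definition L2_space :: "real \<Rightarrow> real \<Rightarrow> (real \<Rightarrow> real) set" where
  "L2_space a b = {f \<in> borel_measurable (lebesgue_on {a..b}).
     integrable (lebesgue_on {a..b}) (\<lambda>y. (f y)\<^sup>2)}"

definition test_functions :: "real \<Rightarrow> real \<Rightarrow> (real \<Rightarrow> real) set" where
  "test_functions a b = {\<phi>. (\<forall>k. (deriv ^^ k) \<phi> differentiable_on UNIV)
     \<and> closure {y. \<phi> y \<noteq> 0} \<subseteq> {a<..<b}}"

definition H1_space :: "real \<Rightarrow> real \<Rightarrow> (real \<Rightarrow> real) set" where
  "H1_space a b = {f \<in> L2_space a b. \<exists>g \<in> L2_space a b.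
     \<forall>\<phi> \<in> test_functions a b. L2_inner a b f (deriv \<phi>) = - L2_inner a b g \<phi>}"

text \<open>
  A function in \<open>H1_space\<close> stands for its class modulo equality almost everywhere, and its point
  values are those of its continuous representative.
\<close>

definition continuous_representative ::
    "real \<Rightarrow> real \<Rightarrow> (real \<Rightarrow> real) \<Rightarrow> (real \<Rightarrow> real) \<Rightarrow> bool" where
  "continuous_representative a b f F \<longleftrightarrow>
     continuous_on {a..b} F \<and> (AE y in lebesgue_on {a..b}. f y = F y)"

section \<open>Dual bases\<close>

definition spd_mats :: "nat \<Rightarrow> real mat set" where
  "spd_mats n = {A \<in> carrier_mat n n. transpose_mat A = A
     \<and> (\<forall>v \<in> carrier_vec n. v \<noteq> 0\<^sub>v n \<longrightarrow> 0 < scalar_prod v (A *\<^sub>v v))}"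

text \<open>Only meaningful for invertible matrices.\<close>

definition inv_mat :: "real mat \<Rightarrow> real mat" where
  "inv_mat A = the (mat_inverse A)"

definition mat_comb :: "nat \<Rightarrow> real mat \<Rightarrow> (nat \<Rightarrow> real \<Rightarrow> real) \<Rightarrow> nat \<Rightarrow> real \<Rightarrow> real" where
  "mat_comb n A B i y = (\<Sum>j<n. A $$ (i, j) * B j y)"

definition gram_mat :: "real \<Rightarrow> real \<Rightarrow> nat \<Rightarrow> (nat \<Rightarrow> real \<Rightarrow> real) \<Rightarrow> real mat" where
  "gram_mat a b n B = mat n n (\<lambda>(i, j). L2_inner a b (B i) (B j))"

definition dual_basis ::
    "real \<Rightarrow> real \<Rightarrow> nat \<Rightarrow> (nat \<Rightarrow> real \<Rightarrow> real) \<Rightarrow> nat \<Rightarrow> real \<Rightarrow> real" where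
  "dual_basis a b n B = mat_comb n (inv_mat (gram_mat a b n B)) B"

definition approx_dual_mat ::
    "real \<Rightarrow> real \<Rightarrow> nat \<Rightarrow> nat \<Rightarrow> (nat \<Rightarrow> real \<Rightarrow> real) \<Rightarrow> real mat \<Rightarrow> bool" where
  "approx_dual_mat a b p n B S \<longleftrightarrow> S \<in> spd_mats n \<and>
     (\<forall>g \<in> poly_space p a b. \<forall>i<n.
        L2_inner a b g (mat_comb n S B i) = L2_inner a b g (dual_basis a b n B i))"

definition discrete_inner ::
    "nat \<Rightarrow> (nat \<Rightarrow> real \<Rightarrow> real) \<Rightarrow> real mat \<Rightarrow> (real \<Rightarrow> real) \<Rightarrow> (real \<Rightarrow> real) \<Rightarrow> real" where
  "discrete_inner n B A u v =
     (\<Sum>i<n. \<Sum>j<n. vec_index (coords n B u) i * A $$ (i, j) * vec_index (coords n B v) j)"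

text \<open>
  \<open>mat_delete A 0 0\<close> is \<open>A\<close> without its first row and column, so that its entry \<open>(i, j)\<close> belongs
  to the pair \<open>B (i + 1)\<close>, \<open>B (j + 1)\<close>. The function below is defined for \<open>1 \<le> i < n\<close>.
\<close>

definition constrained_dual ::
    "nat \<Rightarrow> (nat \<Rightarrow> real \<Rightarrow> real) \<Rightarrow> real mat \<Rightarrow> nat \<Rightarrow> real \<Rightarrow> real" where
  "constrained_dual n B A i =
     mat_comb (n - 1) (inv_mat (mat_delete A 0 0)) (\<lambda>j. B (j + 1)) (i - 1)"

section \<open>Convex minimization problems\<close>

definition convex_problem ::
    "((real \<Rightarrow> real) \<Rightarrow> real) \<Rightarrow> ((real \<Rightarrow> real) \<Rightarrow> bool) \<Rightarrow> bool" where
  "convex_problem J P \<longleftrightarrow> (\<forall>v w. \<forall>s\<in>{0..1}. P v \<longrightarrow> P w \<longrightarrow>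
     P (\<lambda>y. (1 - s) * v y + s * w y) \<and>
     J (\<lambda>y. (1 - s) * v y + s * w y) \<le> (1 - s) * J v + s * J w)"

end

theory Submission
  imports Defs
begin

text \<open>
  Write \<open>A\<close> for the inverse of \<open>S\<close>. In B-spline coordinates the objective is the quadratic
  \<open>c \<mapsto> c\<^sup>T A c / 2 - c\<^sup>T \<beta>\<close> with \<open>\<beta>\<^sub>i = \<langle>B\<^sub>i, f\<rangle>\<close>, and the constraint is \<open>c\<^sub>0 = 0\<close>, since
  \<open>B\<^sub>0\<close> is the only B-spline that does not vanish at \<open>a\<close>. The coordinates \<open>d\<close> of \<open>u\<close> solve the
  equations \<open>(A d)\<^sub>i = \<beta>\<^sub>i\<close>, \<open>i > 0\<close>, so that the objective at \<open>c\<close> exceeds the one at \<open>d\<close> by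
  \<open>(c - d)\<^sup>T A (c - d) / 2\<close>. If \<open>f\<close> is a polynomial with coordinates \<open>c\<close>, which exist by Marsden's
  identity, the duality condition on \<open>S\<close> says \<open>S \<beta> = c\<close>; hence \<open>A c = \<beta>\<close>, and \<open>c\<close> solves the same
  equations as \<open>d\<close>. The B-splines are linearly independent because, to the right of a knot, those
  that begin there vanish to different orders.
\<close>

section \<open>The Cox--de Boor recursion\<close>

text \<open>Stated through the B-splines of degree 0 instead of
  \<open>t m \<le> y < t (m + 1)\<close>, so that it also covers \<open>y = b\<close>, where the
  last nonempty knot interval is closed.\<close>

definition active_interval :: "(nat \<Rightarrow> real) \<Rightarrow> real \<Rightarrow> nat \<Rightarrow> real \<Rightarrow> bool" where
  "active_interval t b m y \<longleftrightarrow> (\<forall>i. bspline t b 0 i y = of_bool (i = m))"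

lemma active_intervalI:
  fixes t :: "nat \<Rightarrow> real"
  assumes "mono t" and tb: "\<And>i. t i \<le> b" and "t m \<le> y" "y < t (m + 1)"
  shows "active_interval t b m y"
  unfolding active_interval_def
proof
  fix i
  consider "i < m" | "i = m" | "m < i" by linarith
  then show "bspline t b 0 i y = of_bool (i = m)"
  proof cases
    case 1
    then have "t (i + 1) \<le> t m" using \<open>mono t\<close> by (auto intro: monoD)
    then show ?thesis using 1 assms(3,4) tb[of "m + 1"] by auto
  next
    case 2
    then show ?thesis using assms(3,4) by auto
  next
    case 3
    then have "t (m + 1) \<le> t i" using \<open>mono t\<close> by (auto intro: monoD)
    then show ?thesis using 3 assms(3,4) tb[of "m + 1"] by auto
  qed
qed

lemma bspline_eq_0:
  assumes "active_interval t b m y" and "\<not> (i \<le> m \<and> m \<le> i + q)"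
  shows "bspline t b q i y = 0"
  using assms(2)
proof (induction q arbitrary: i)
  case 0
  then show ?case using assms(1) unfolding active_interval_def by auto
next
  case (Suc q)
  have "bspline t b q i y = 0" "bspline t b q (i + 1) y = 0"
    using Suc.prems by (auto intro!: Suc.IH simp del: bspline.simps)
  then show ?case by (simp del: bspline.simps(1))
qed

text \<open>Induction on \<open>q\<close>: expand by the recursion and collect, after an index
  shift, the terms with the same B-spline of degree \<open>q\<close>. Their joint factor is the
  linear interpolant of \<open>z - \<tau>\<close> through \<open>z = t i\<close> and
  \<open>z = t (i + Suc q)\<close>, evaluated at \<open>y\<close>, hence \<open>y - \<tau>\<close>.
  The sum may stop at \<open>m\<close> because later B-splines vanish at \<open>y\<close>.\<close>

lemma marsden_identity:
  fixes t :: "nat \<Rightarrow> real"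
  assumes act: "active_interval t b m y" and "mono t" and tm: "t m < t (m + 1)" and "q \<le> m"
  shows "(\<Sum>i\<le>m. bspline t b q i y * (\<Prod>j<q. t (i + 1 + j) - \<tau>)) = (y - \<tau>) ^ q"
  using \<open>q \<le> m\<close>
proof (induction q)
  case 0
  have "(\<Sum>i\<le>m. bspline t b 0 i y) = (\<Sum>i\<le>m. if i = m then 1 else 0)"
    using act unfolding active_interval_def by (intro sum.cong) auto
  then show ?case by (simp del: bspline.simps)
next
  case (Suc q)
  define D where "D i = t (i + Suc q) - t i" for i
  define \<psi> where "\<psi> i = (\<Prod>j<q. t (i + 1 + j) - \<tau>)" for i
  define \<psi>' where "\<psi>' i = (\<Prod>j<Suc q. t (i + 1 + j) - \<tau>)" for i
  let ?B = "\<lambda>i. bspline t b q i y"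
  \<comment> \<open>\<open>V (Suc i)\<close> is the second summand of the recursion for index
    \<open>i\<close>; the shift puts it next to the first summand for \<open>Suc i\<close>, which
    has the same factor \<open>?B (Suc i)\<close>.\<close>
  define V where "V i = (t (i + Suc q) - y) / D i * ?B i * ((t i - \<tau>) * \<psi> i)" for i
  have \<psi>': "\<psi>' i = \<psi> i * (t (i + Suc q) - \<tau>)" for i
    unfolding \<psi>'_def \<psi>_def by simp
  have \<psi>'_shift: "\<psi>' i = (t (Suc i) - \<tau>) * \<psi> (Suc i)" for i
    unfolding \<psi>'_def \<psi>_def by (subst prod.lessThan_Suc_shift) simp
  \<comment> \<open>Boundary terms of the shift: the support of index 0 ends before the active
    interval because \<open>q < m\<close>, that of \<open>Suc m\<close> begins after it.\<close>
  have "?B 0 = 0" "?B (Suc m) = 0"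
    using Suc.prems by (auto intro!: bspline_eq_0[OF act] simp del: bspline.simps)
  then have V0: "V 0 = 0" "V (Suc m) = 0"
    by (simp_all add: V_def)
  have "(\<Sum>i\<le>m. bspline t b (Suc q) i y * \<psi>' i)
      = (\<Sum>i\<le>m. (y - t i) / D i * ?B i * \<psi>' i + V (Suc i))"
    by (intro sum.cong) (auto simp add: V_def D_def \<psi>'_shift algebra_simps simp del: bspline.simps(1))
  also have "\<dots> = (\<Sum>i\<le>m. (y - t i) / D i * ?B i * \<psi>' i) + (\<Sum>i\<le>m. V (Suc i))"
    by (rule sum.distrib)
  also have "(\<Sum>i\<le>m. V (Suc i)) = (\<Sum>i\<le>Suc m. V i)"
    unfolding sum.atMost_Suc_shift using V0 by simp
  also have "\<dots> = (\<Sum>i\<le>m. V i)"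
    using V0 by simp
  also have "(\<Sum>i\<le>m. (y - t i) / D i * ?B i * \<psi>' i) + (\<Sum>i\<le>m. V i)
      = (\<Sum>i\<le>m. (y - \<tau>) * (?B i * \<psi> i))"
    unfolding sum.distrib[symmetric]
  proof (rule sum.cong)
    fix i assume "i \<in> {..m}"
    show "(y - t i) / D i * ?B i * \<psi>' i + V i = (y - \<tau>) * (?B i * \<psi> i)"
    \<comment> \<open>Where \<open>?B i\<close> may be nonzero, its knots enclose the active
      interval and \<open>D i\<close> is nonzero; elsewhere the value of the quotient does not
      matter.\<close>
    proof (cases "m \<le> i + q")
      case True
      then have "t i \<le> t m" "t (m + 1) \<le> t (i + Suc q)"
        using \<open>i \<in> {..m}\<close> \<open>mono t\<close> by (auto intro: monoD)
      then have "D i \<noteq> 0" using tm by (simp add: D_def)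
      have "(y - t i) * (t (i + Suc q) - \<tau>) + (t (i + Suc q) - y) * (t i - \<tau>) = (y - \<tau>) * D i"
        by (simp add: D_def algebra_simps)
      then have "((y - t i) * (t (i + Suc q) - \<tau>) + (t (i + Suc q) - y) * (t i - \<tau>)) / D i = y - \<tau>"
        using \<open>D i \<noteq> 0\<close> by simp
      then have "(y - t i) / D i * (t (i + Suc q) - \<tau>) + (t (i + Suc q) - y) / D i * (t i - \<tau>) = y - \<tau>"
        by (simp add: add_divide_distrib)
      then have "((y - t i) / D i * (t (i + Suc q) - \<tau>) + (t (i + Suc q) - y) / D i * (t i - \<tau>)) * (?B i * \<psi> i)
          = (y - \<tau>) * (?B i * \<psi> i)"
        by simp
      then show ?thesis
        unfolding V_def \<psi>' by (simp only: algebra_simps)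
    next
      case False
      then have "?B i = 0" by (intro bspline_eq_0[OF act]) auto
      then show ?thesis by (simp add: V_def)
    qed
  qed simp
  also have "\<dots> = (y - \<tau>) ^ Suc q"
    using Suc by (simp add: \<psi>_def sum_distrib_left[symmetric])
  finally show ?case by (simp only: \<psi>'_def)
qed

text \<open>At the multiple knot the first summand of the recursion vanishes, and the second passes
  the value at index \<open>i + 1\<close> on to \<open>i\<close> with weight 1. Each degree thus
  moves the single nonzero index down by one.\<close>

lemma bspline_left_end:
  assumes "active_interval t b p (t p)" and "\<And>i. i \<le> p \<Longrightarrow> t i = t p" and "t p < t (p + 1)" and "q \<le> p"
  shows "bspline t b q i (t p) = of_bool (i + q = p)"
  using \<open>q \<le> p\<close>
proof (induction q arbitrary: i)
  case 0
  then show ?case using assms(1) unfolding active_interval_def by simp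
next
  case (Suc q)
  have "q \<le> p" using Suc.prems by simp
  note IH = Suc.IH[OF this]
  consider "i + q = p" | "i + Suc q = p" | "i + q \<noteq> p" "i + Suc q \<noteq> p" by blast
  then show ?case
  proof cases
    case 1
    then have "t i = t p" by (intro assms(2)) simp
    with 1 show ?thesis by (simp only: bspline.simps(2) IH) simp
  next
    case 2
    then have "t (i + 1) = t p" "i + Suc q + 1 = p + 1"
      using assms(2)[of "i + 1"] by simp_all
    then show ?thesis using 2 assms(3) by (simp only: bspline.simps(2) IH) auto
  next
    case 3
    then show ?thesis by (simp only: bspline.simps(2) IH) auto
  qed
qed

text \<open>
  To the right of a knot where \<open>l\<close> of the knots of a B-spline of degree \<open>q\<close> coincide, the B-spline
  vanishes to order exactly \<open>q + 1 - l\<close>; here \<open>l = m + 1 - j\<close>.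
\<close>

lemma bspline_at_right:
  fixes t :: "nat \<Rightarrow> real"
  assumes "mono t" and tb: "\<And>i. t i \<le> b" and tm: "t m < t (m + 1)"
    and "t j = t m" and "j \<le> m" and "m \<le> j + q"
  shows "\<exists>L>0. ((\<lambda>y. bspline t b q j y / (y - t m) ^ (q + j - m)) \<longlongrightarrow> L) (at_right (t m))"
  using \<open>t j = t m\<close> \<open>j \<le> m\<close> \<open>m \<le> j + q\<close>
proof (induction q arbitrary: j)
  case 0
  then have "j = m" by simp
  have "\<forall>\<^sub>F y in at_right (t m). y < t (m + 1)" and "\<forall>\<^sub>F y in at_right (t m). t m < y"
    using tm by (auto simp: eventually_at_right_less eventually_at_right_field)
  then have "\<forall>\<^sub>F y in at_right (t m). bspline t b 0 j y / (y - t m) ^ (0 + j - m) = 1"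
    by eventually_elim (simp add: \<open>j = m\<close>)
  then show ?case by (intro exI[of _ 1]) (simp add: tendsto_eventually)
next
  case (Suc q)
  have near: "\<forall>\<^sub>F y in at_right (t m). t m < y \<and> y < t (m + 1)"
    using tm by (auto simp: eventually_at_right_field)
  define k where "k = Suc q + j - m"
  have d2: "t (j + Suc q + 1) \<ge> t (m + 1)"
    using Suc.prems \<open>mono t\<close> by (auto intro: monoD)
  \<comment> \<open>Both summands of the recursion are compared with the same power
    \<open>k\<close>. Their limits are nonnegative; the first is positive for \<open>j = m\<close>,
    the second for \<open>j < m\<close>, so that no cancellation can raise the order.\<close>
  have "\<exists>L. 0 \<le> L \<and> (m \<le> j + q \<and> m = j \<longrightarrow> 0 < L) \<and>
      ((\<lambda>y. (y - t j) / (t (j + Suc q) - t j) * bspline t b q j y / (y - t m) ^ k) \<longlongrightarrow> L) (at_right (t m))"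
  proof (cases "m \<le> j + q")
    case True
    obtain L where L: "L > 0" "((\<lambda>y. bspline t b q j y / (y - t m) ^ (q + j - m)) \<longlongrightarrow> L) (at_right (t m))"
      using Suc.IH[OF Suc.prems(1,2) True] by blast
    have "t (m + 1) \<le> t (j + Suc q)" using True \<open>mono t\<close> by (auto intro: monoD)
    then have D: "0 < t (j + Suc q) - t j" using tm Suc.prems by simp
    have "((\<lambda>y. bspline t b q j y / (y - t m) ^ (q + j - m) / (t (j + Suc q) - t j))
        \<longlongrightarrow> L / (t (j + Suc q) - t j)) (at_right (t m))"
      by (intro tendsto_divide L tendsto_const) (use D in auto)
    moreover have "\<forall>\<^sub>F y in at_right (t m). bspline t b q j y / (y - t m) ^ (q + j - m) / (t (j + Suc q) - t j)
       = (y - t j) / (t (j + Suc q) - t j) * bspline t b q j y / (y - t m) ^ k"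
      using near
    proof eventually_elim
      case (elim y)
      \<comment> \<open>The additional power comes from the factor
        \<open>y - t j = y - t m\<close>.\<close>
      have "k = Suc (q + j - m)" using True by (simp add: k_def)
      then show ?case using elim Suc.prems(1) by simp
    qed
    ultimately show ?thesis using L(1) D
      by (intro exI[of _ "L / (t (j + Suc q) - t j)"]) (auto intro: Lim_transform_eventually)
  next
    case False
    \<comment> \<open>All knots from \<open>j\<close> to \<open>m\<close> coincide here; the
      denominator is 0, and so is the summand by the division convention.\<close>
    then have "j + Suc q = m" using Suc.prems by simp
    then have "t (j + Suc q) - t j = 0" using Suc.prems by simp
    then show ?thesis using False by (intro exI[of _ 0]) simp
  qed
  then obtain L1 where L1: "0 \<le> L1" "m \<le> j + q \<and> m = j \<longrightarrow> 0 < L1"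
      "((\<lambda>y. (y - t j) / (t (j + Suc q) - t j) * bspline t b q j y / (y - t m) ^ k) \<longlongrightarrow> L1) (at_right (t m))"
    by blast
  have "\<exists>L. 0 \<le> L \<and> (j < m \<longrightarrow> 0 < L) \<and>
      ((\<lambda>y. (t (j + Suc q + 1) - y) / (t (j + Suc q + 1) - t (j + 1)) * bspline t b q (j + 1) y / (y - t m) ^ k) \<longlongrightarrow> L) (at_right (t m))"
  proof (cases "j < m")
    case True
    have "t j \<le> t (j + 1)" "t (j + 1) \<le> t m" using True \<open>mono t\<close> by (auto intro: monoD)
    then have tj: "t (j + 1) = t m" using Suc.prems by simp
    obtain L where L: "L > 0" "((\<lambda>y. bspline t b q (j + 1) y / (y - t m) ^ (q + (j + 1) - m)) \<longlongrightarrow> L) (at_right (t m))"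
      using Suc.IH[of "j + 1"] tj True Suc.prems(3) by auto
    have D: "t (j + Suc q + 1) - t (j + 1) > 0" using d2 tj tm by simp
    have "((\<lambda>y. (t (j + Suc q + 1) - y) / (t (j + Suc q + 1) - t (j + 1)) * (bspline t b q (j + 1) y / (y - t m) ^ (q + (j + 1) - m)))
        \<longlongrightarrow> (t (j + Suc q + 1) - t m) / (t (j + Suc q + 1) - t (j + 1)) * L) (at_right (t m))"
      by (intro tendsto_intros L) (use D in auto)
    then show ?thesis using L(1) D tj True
      by (intro exI[of _ "(t (j + Suc q + 1) - t m) / (t (j + Suc q + 1) - t (j + 1)) * L"])
         (auto simp: k_def)
  next
    case False
    \<comment> \<open>Now \<open>j = m\<close>, and the B-spline with index \<open>m + 1\<close>
      begins only at \<open>t (m + 1)\<close>.\<close>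
    have "\<forall>\<^sub>F y in at_right (t m). bspline t b q (j + 1) y = 0"
      using near
    proof eventually_elim
      case (elim y)
      have "active_interval t b m y"
        using active_intervalI[OF \<open>mono t\<close> tb] elim by simp
      then show ?case using False by (intro bspline_eq_0) auto
    qed
    then have "\<forall>\<^sub>F y in at_right (t m). (t (j + Suc q + 1) - y) / (t (j + Suc q + 1) - t (j + 1)) * bspline t b q (j + 1) y / (y - t m) ^ k = 0"
      by eventually_elim simp
    then show ?thesis using False by (intro exI[of _ 0]) (auto intro: tendsto_eventually)
  qed
  then obtain L2 where L2: "0 \<le> L2" "j < m \<longrightarrow> 0 < L2"
      "((\<lambda>y. (t (j + Suc q + 1) - y) / (t (j + Suc q + 1) - t (j + 1)) * bspline t b q (j + 1) y / (y - t m) ^ k) \<longlongrightarrow> L2) (at_right (t m))"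
    by blast
  have "0 < L1 + L2"
    using L1(1,2) L2(1,2) Suc.prems by (cases "j < m") auto
  moreover have "((\<lambda>y. bspline t b (Suc q) j y / (y - t m) ^ k) \<longlongrightarrow> L1 + L2) (at_right (t m))"
    using tendsto_add[OF L1(3) L2(3)] by (simp add: add_divide_distrib)
  ultimately show ?case by (auto simp: k_def)
qed

section \<open>Measurability and boundedness of B-splines\<close>

lemma borel_measurable_bspline [measurable]: "bspline t b q i \<in> borel_measurable borel"
proof (induction q arbitrary: i)
  case 0
  show ?case by simp
next
  case (Suc q)
  note [measurable] = Suc.IH
  show ?case by simp
qed

lemma bspline_bounded:
  fixes t :: "nat \<Rightarrow> real"
  shows "\<exists>C. \<forall>y\<in>{a..b'}. \<bar>bspline t b q i y\<bar> \<le> C"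
proof (induction q arbitrary: i)
  case 0
  show ?case by (intro exI[of _ 1]) auto
next
  case (Suc q)
  obtain C where C: "\<forall>y\<in>{a..b'}. \<bar>bspline t b q i y\<bar> \<le> C" using Suc.IH by blast
  obtain C' where C': "\<forall>y\<in>{a..b'}. \<bar>bspline t b q (i + 1) y\<bar> \<le> C'" using Suc.IH by blast
  have affine: "\<bar>(y - c) / d\<bar> \<le> (\<bar>a\<bar> + \<bar>b'\<bar> + \<bar>c\<bar>) / \<bar>d\<bar>" if "y \<in> {a..b'}" for y c d :: real
    using that unfolding abs_divide by (intro divide_right_mono) auto
  have "\<bar>bspline t b (Suc q) i y\<bar> \<le>
      (\<bar>a\<bar> + \<bar>b'\<bar> + \<bar>t i\<bar>) / \<bar>t (i + Suc q) - t i\<bar> * C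
      + (\<bar>a\<bar> + \<bar>b'\<bar> + \<bar>t (i + Suc q + 1)\<bar>) / \<bar>t (i + Suc q + 1) - t (i + 1)\<bar> * C'"
    if y: "y \<in> {a..b'}" for y
  proof -
    have "\<bar>(t (i + Suc q + 1) - y) / (t (i + Suc q + 1) - t (i + 1))\<bar>
      \<le> (\<bar>a\<bar> + \<bar>b'\<bar> + \<bar>t (i + Suc q + 1)\<bar>) / \<bar>t (i + Suc q + 1) - t (i + 1)\<bar>"
      using affine[OF y, of "t (i + Suc q + 1)" "t (i + Suc q + 1) - t (i + 1)"]
      by (simp add: abs_divide abs_minus_commute)
    then show ?thesis
      unfolding bspline.simps(2) using affine[OF y] C C' y
      by (intro order.trans[OF abs_triangle_ineq] add_mono) (auto simp only: abs_mult intro!: mult_mono divide_nonneg_nonneg)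
  qed
  then show ?case by blast
qed

section \<open>Clamped knot vectors\<close>

text \<open>The knots form a total sequence, constantly \<open>b\<close> from index \<open>n\<close>
  on, so that monotonicity needs no index bounds. \<open>knots_less\<close> says that each of the
  \<open>n\<close> B-splines has a nondegenerate support.\<close>

locale clamped_knots =
  fixes t :: "nat \<Rightarrow> real" and p n :: nat and a b :: real
  assumes mono_knots: "mono t"
    and knots_left: "i \<le> p \<Longrightarrow> t i = a"
    and knots_right: "n \<le> i \<Longrightarrow> t i = b"
    and knots_less: "i < n \<Longrightarrow> t i < t (i + p + 1)"
    and degree_less: "p < n"
begin

abbreviation "N \<equiv> bspline t b p"

lemma knots_le_right: "t i \<le> b"
  using monoD[OF mono_knots, of i "max i n"] knots_right[of "max i n"] by simp

lemma knots_ge_left: "a \<le> t i"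
  using monoD[OF mono_knots, of 0 i] knots_left[of 0] by simp

lemma left_less_knot: "a < t (p + 1)"
  using knots_less[of 0] knots_left[of 0] degree_less by simp

text \<open>For \<open>y < b\<close>, take the index before the first knot beyond \<open>y\<close>;
  for \<open>y = b\<close>, take \<open>n - 1\<close>, the last nonempty interval. The bound
  \<open>p \<le> m\<close> is what Marsden's identity needs in degree \<open>p\<close>.\<close>

lemma ex_active_interval:
  assumes "y \<in> {a..b}"
  shows "\<exists>m. p \<le> m \<and> m < n \<and> t m < t (m + 1) \<and> active_interval t b m y"
proof (cases "y < b")
  case True
  define k where "k = (LEAST i. y < t i)"
  have ex: "y < t n" using knots_right[of n] True by simp
  have k: "y < t k" "k \<le> n"
    unfolding k_def using ex by (rule LeastI, rule Least_le)
  have "p < k"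
  proof (rule ccontr)
    assume "\<not> p < k"
    then have "t k = a" by (simp add: knots_left)
    then show False using k assms by simp
  qed
  define m where "m = k - 1"
  have m: "k = m + 1" "p \<le> m"
    using \<open>p < k\<close> by (simp_all add: m_def)
  have "t m \<le> y" using not_less_Least[of m "\<lambda>i. y < t i"] m(1) by (simp add: k_def[symmetric] not_less)
  then have "active_interval t b m y" "t m < t (m + 1)"
    using active_intervalI[OF mono_knots knots_le_right] k m by auto
  then show ?thesis using m k by auto
next
  case False
  then have y: "y = b" using assms by simp
  define m where "m = n - 1"
  have m: "n = m + 1" "p \<le> m"
    using degree_less by (simp_all add: m_def)
  have tm: "t m < t (m + 1)"
    using knots_less[of m] knots_right[of "m + p + 1"] knots_right[of "m + 1"] m(1) by simp
  have "bspline t b 0 i y = of_bool (i = m)" for i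
  proof -
    consider "i < m" | "i = m" | "m < i" by linarith
    then show ?thesis
    proof cases
      case 1
      then have "t (i + 1) \<le> t m" using mono_knots by (auto intro: monoD)
      then show ?thesis using 1 y tm knots_right[of "m + 1"] m by auto
    next
      case 2
      then show ?thesis using tm y knots_right[of "m + 1"] m by auto
    next
      case 3
      then have "t i = b" "t (i + 1) = b" using m by (auto intro: knots_right)
      then show ?thesis using 3 y by auto
    qed
  qed
  then show ?thesis using m tm by (auto simp: active_interval_def)
qed

lemma bspline_at_left_end: "N i a = of_bool (i = 0)"
proof -
  have "active_interval t b p a"
    using active_intervalI[OF mono_knots knots_le_right] left_less_knot knots_left[of p] by simp
  then show ?thesis
    using bspline_left_end[of t b p p i] left_less_knot knots_left by simp
qed

text \<open>Both sides of Marsden's identity are polynomials in \<open>\<tau>\<close>. Comparing the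
  coefficients of \<open>\<tau> ^ (p - k)\<close> gives \<open>e * y ^ k\<close> on the right and,
  on the left, B-spline coefficients that do not depend on \<open>y\<close>.\<close>

lemma monom_in_span:
  assumes "k \<le> p"
  shows "\<exists>c. \<forall>y\<in>{a..b}. y ^ k = (\<Sum>i<n. c i * N i y)"
proof -
  define \<Psi> where "\<Psi> i = (\<Prod>j<p. [:t (i + 1 + j), -1:])" for i
  define e where "e = real (p choose (p - k)) * (-1) ^ (p - k)"
  have "e \<noteq> 0" by (simp add: e_def)
  have "y ^ k = (\<Sum>i<n. coeff (\<Psi> i) (p - k) / e * N i y)" if y: "y \<in> {a..b}" for y
  proof -
    obtain m where m: "p \<le> m" "m < n" "t m < t (m + 1)" "active_interval t b m y"
      using ex_active_interval[OF y] by blast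
    have eq: "(\<Sum>i<n. Polynomial.smult (N i y) (\<Psi> i)) = [:y, -1:] ^ p"
    proof (rule poly_eq_poly_eq_iff[THEN iffD1], rule ext)
      fix \<tau>
      have "poly (\<Sum>i<n. Polynomial.smult (N i y) (\<Psi> i)) \<tau> = (\<Sum>i<n. N i y * (\<Prod>j<p. t (i + 1 + j) - \<tau>))"
        by (simp add: poly_sum \<Psi>_def poly_prod)
      also have "\<dots> = (\<Sum>i\<le>m. N i y * (\<Prod>j<p. t (i + 1 + j) - \<tau>))"
        using m(2) by (intro sum.mono_neutral_right) (auto simp: bspline_eq_0[OF m(4)])
      also have "\<dots> = poly ([:y, -1:] ^ p) \<tau>"
        using marsden_identity[OF m(4) mono_knots m(3,1)] by simp
      finally show "poly (\<Sum>i<n. Polynomial.smult (N i y) (\<Psi> i)) \<tau> = poly ([:y, -1:] ^ p) \<tau>" .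
    qed
    have "(\<Sum>i<n. N i y * coeff (\<Psi> i) (p - k)) = coeff ([:y, -1:] ^ p) (p - k)"
      unfolding eq[symmetric] by (simp add: coeff_sum)
    also have "\<dots> = e * y ^ k"
      using assms by (simp add: coeff_linear_poly_power e_def)
    finally have "y ^ k = (\<Sum>i<n. N i y * coeff (\<Psi> i) (p - k)) / e"
      using \<open>e \<noteq> 0\<close> by simp
    then show ?thesis
      by (simp add: sum_divide_distrib mult.commute)
  qed
  then show ?thesis by (intro exI[of _ "\<lambda>i. coeff (\<Psi> i) (p - k) / e"]) blast
qed

lemma poly_in_span:
  assumes "g \<in> poly_space p a b"
  shows "\<exists>c. \<forall>y\<in>{a..b}. g y = (\<Sum>i<n. c i * N i y)"
proof -
  obtain q where q: "degree q \<le> p" "\<forall>y\<in>{a..b}. g y = poly q y"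
    using assms unfolding poly_space_def by blast
  obtain C where C: "\<And>k y. k \<le> p \<Longrightarrow> y \<in> {a..b} \<Longrightarrow> y ^ k = (\<Sum>i<n. C k i * N i y)"
    using monom_in_span by metis
  have "g y = (\<Sum>i<n. (\<Sum>k\<le>degree q. coeff q k * C k i) * N i y)" if "y \<in> {a..b}" for y
  proof -
    have "g y = (\<Sum>k\<le>degree q. coeff q k * (\<Sum>i<n. C k i * N i y))"
      using q that C by (simp add: poly_altdef)
    also have "\<dots> = (\<Sum>i<n. (\<Sum>k\<le>degree q. coeff q k * C k i) * N i y)"
      by (simp add: sum_distrib_left sum_distrib_right mult.assoc) (rule sum.swap)
    finally show ?thesis .
  qed
  then show ?thesis by (intro exI[of _ "\<lambda>i. \<Sum>k\<le>degree q. coeff q k * C k i"]) blast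
qed

text \<open>Let \<open>i0\<close> be the first index with a nonzero coefficient and \<open>m\<close>
  the last index with \<open>t m = t i0\<close>. Just to the right of \<open>t m\<close> only the
  B-splines \<open>i0\<close> to \<open>m\<close> contribute, and the one with index
  \<open>i0\<close> dominates, as it vanishes to the lowest order. An interval rather than a point
  is needed for integrals.\<close>

lemma ex_spline_nonzero_interval:
  assumes "i < n" and "c i \<noteq> 0"
  shows "\<exists>\<alpha> \<beta>. a \<le> \<alpha> \<and> \<alpha> < \<beta> \<and> \<beta> \<le> b \<and> (\<forall>y\<in>{\<alpha><..<\<beta>}. (\<Sum>j<n. c j * N j y) \<noteq> 0)"
proof -
  define i0 where "i0 = (LEAST j. c j \<noteq> 0)"
  have i0: "c i0 \<noteq> 0" "i0 \<le> i"
    unfolding i0_def using assms(2) by (rule LeastI, rule Least_le)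
  have c0: "c j = 0" if "j < i0" for j
    using not_less_Least[of j "\<lambda>j. c j \<noteq> 0"] that by (auto simp: i0_def)
  have "i0 < n" using i0 assms by simp
  define k where "k = (LEAST j. t i0 < t j)"
  have k: "t i0 < t k" "k \<le> i0 + p + 1"
    unfolding k_def using knots_less[OF \<open>i0 < n\<close>] by (rule LeastI, rule Least_le)
  have "i0 < k"
    using k(1) monoD[OF mono_knots, of k i0] by (cases "i0 < k") auto
  define m where "m = k - 1"
  have m: "k = m + 1" "i0 \<le> m"
    using \<open>i0 < k\<close> by (simp_all add: m_def)
  have "\<not> t i0 < t m" using not_less_Least[of m "\<lambda>j. t i0 < t j"] m(1) by (simp add: k_def[symmetric])
  then have eq: "t j = t m" if "i0 \<le> j" "j \<le> m" for j
    using that m monoD[OF mono_knots, of i0 j] monoD[OF mono_knots, of j m] by simp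
  have tm: "t m < t (m + 1)" using k m eq[of i0] by simp
  have mp: "m \<le> i0 + p" using k m by simp
  have "m < n"
    using tm knots_right[of m] knots_le_right[of "m + 1"] by (cases "m < n") auto
  have "\<forall>j\<in>{i0..m}. \<exists>L. 0 < L \<and> ((\<lambda>y. N j y / (y - t m) ^ (p + j - m)) \<longlongrightarrow> L) (at_right (t m))"
  proof
    fix j assume "j \<in> {i0..m}"
    then show "\<exists>L. 0 < L \<and> ((\<lambda>y. N j y / (y - t m) ^ (p + j - m)) \<longlongrightarrow> L) (at_right (t m))"
      using mp eq[of j] by (intro bspline_at_right mono_knots knots_le_right tm) auto
  qed
  from bchoice[OF this] obtain L where L: "\<And>j. j \<in> {i0..m} \<Longrightarrow> L j > 0"
    "\<And>j. j \<in> {i0..m} \<Longrightarrow> ((\<lambda>y. N j y / (y - t m) ^ (p + j - m)) \<longlongrightarrow> L j) (at_right (t m))"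
    by blast
  \<comment> \<open>This is the spline divided by \<open>(y - t m) ^ (p + i0 - m)\<close>. In the
    limit only \<open>j = i0\<close> survives, by \<open>0 ^ 0 = 1\<close>.\<close>
  have "((\<lambda>y. \<Sum>j\<in>{i0..m}. c j * (N j y / (y - t m) ^ (p + j - m) * (y - t m) ^ (j - i0)))
      \<longlongrightarrow> (\<Sum>j\<in>{i0..m}. c j * (L j * (t m - t m) ^ (j - i0)))) (at_right (t m))"
    by (intro tendsto_intros L)
  moreover have "(\<Sum>j\<in>{i0..m}. c j * (L j * (t m - t m) ^ (j - i0))) = (\<Sum>j\<in>{i0..m}. if j = i0 then c i0 * L i0 else 0)"
    by (intro sum.cong) auto
  moreover have "\<dots> = c i0 * L i0" using m by simp
  moreover have "c i0 * L i0 \<noteq> 0" using i0 L(1)[of i0] m by simp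
  ultimately have "\<forall>\<^sub>F y in at_right (t m). (\<Sum>j\<in>{i0..m}. c j * (N j y / (y - t m) ^ (p + j - m) * (y - t m) ^ (j - i0))) \<noteq> 0"
    by (intro tendsto_imp_eventually_ne[where c = "c i0 * L i0"]) simp_all
  moreover have "\<forall>\<^sub>F y in at_right (t m). t m < y \<and> y < t (m + 1)"
    using tm by (auto simp: eventually_at_right_field)
  ultimately have "\<forall>\<^sub>F y in at_right (t m). (\<Sum>j<n. c j * N j y) \<noteq> 0"
  proof eventually_elim
    case (elim y)
    have act: "active_interval t b m y"
      using active_intervalI[OF mono_knots knots_le_right] elim by simp
    have "(\<Sum>j<n. c j * N j y) = (\<Sum>j\<in>{i0..m}. c j * N j y)"
      using \<open>m < n\<close> by (intro sum.mono_neutral_right) (auto simp: c0 bspline_eq_0[OF act] not_le)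
    also have "\<dots> = (y - t m) ^ (p + i0 - m) * (\<Sum>j\<in>{i0..m}. c j * (N j y / (y - t m) ^ (p + j - m) * (y - t m) ^ (j - i0)))"
      unfolding sum_distrib_left
    proof (rule sum.cong)
      fix j assume "j \<in> {i0..m}"
      then have "p + j - m = (p + i0 - m) + (j - i0)" using mp by auto
      then show "c j * N j y = (y - t m) ^ (p + i0 - m) * (c j * (N j y / (y - t m) ^ (p + j - m) * (y - t m) ^ (j - i0)))"
        using elim by (simp add: power_add)
    qed simp
    finally show ?case using elim by simp
  qed
  then obtain \<beta> where \<beta>: "t m < \<beta>" "\<And>y. t m < y \<Longrightarrow> y < \<beta> \<Longrightarrow> (\<Sum>j<n. c j * N j y) \<noteq> 0"
    by (auto simp: eventually_at_right_field)
  show ?thesis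
    using \<beta> tm knots_ge_left[of m] knots_le_right[of "m + 1"]
    by (intro exI[of _ "t m"] exI[of _ "min \<beta> (t (m + 1))"]) auto
qed

lemma coeffs_unique:
  assumes "\<And>y. y \<in> {a..b} \<Longrightarrow> (\<Sum>j<n. c j * N j y) = (\<Sum>j<n. d j * N j y)" and "i < n"
  shows "c i = d i"
proof (rule ccontr)
  assume "c i \<noteq> d i"
  then obtain \<alpha> \<beta> where *: "a \<le> \<alpha>" "\<alpha> < \<beta>" "\<beta> \<le> b" "\<forall>y\<in>{\<alpha><..<\<beta>}. (\<Sum>j<n. (c j - d j) * N j y) \<noteq> 0"
    using ex_spline_nonzero_interval[of i "\<lambda>j. c j - d j"] assms(2) by auto
  obtain y where y: "\<alpha> < y" "y < \<beta>" using dense *(2) by blast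
  then show False
    using * assms(1)[of y] by (auto simp: algebra_simps sum_subtractf)
qed

end

section \<open>From the knot list to a clamped knot vector\<close>

lemma count_list_replicate: "count_list (replicate k c) v = (if c = v then k else 0)"
  by (induction k) auto

lemma count_list_concat_replicate_le:
  assumes "distinct ks" and "inj_on x (set ks)" and "\<And>k. k \<in> set ks \<Longrightarrow> \<mu> k \<le> M"
  shows "count_list (concat (map (\<lambda>k. replicate (\<mu> k) (x k)) ks)) v \<le> M"
  using assms
proof (induction ks)
  case (Cons k ks)
  let ?r = "concat (map (\<lambda>k. replicate (\<mu> k) (x k)) ks)"
  have "count_list ?r v \<le> M" using Cons by simp
  moreover have "x k \<notin> set ?r" using Cons.prems by auto
  ultimately show ?case using Cons.prems(3)[of k] by (auto simp: count_list_replicate)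
qed simp

lemma sorted_concat_replicate:
  "sorted (map x ks) \<Longrightarrow> sorted (concat (map (\<lambda>k. replicate (\<mu> k) (x k)) ks))"
  by (induction ks) (auto simp: sorted_append)

text \<open>Otherwise the \<open>k + 1\<close> entries at positions \<open>i\<close> to
  \<open>i + k\<close> would all be equal, by sortedness, and exceed the count.\<close>

lemma sorted_nth_less:
  fixes xs :: "'a::linorder list"
  assumes "sorted xs" and "i + k < length xs" and "count_list xs (xs ! i) \<le> k"
  shows "xs ! i < xs ! (i + k)"
proof (rule ccontr)
  assume "\<not> xs ! i < xs ! (i + k)"
  then have le: "xs ! (i + k) \<le> xs ! i" by simp
  have eq: "xs ! i = xs ! j" if "i \<le> j" "j \<le> i + k" for j
  proof (rule antisym)
    show "xs ! i \<le> xs ! j"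
      using that assms(2) by (intro sorted_nth_mono[OF assms(1)]) auto
    have "xs ! j \<le> xs ! (i + k)"
      using that assms(2) by (intro sorted_nth_mono[OF assms(1)]) auto
    then show "xs ! j \<le> xs ! i" using le by (rule order.trans)
  qed
  have "{i..i + k} \<subseteq> {j. j < length xs \<and> xs ! i = xs ! j}"
    using assms(2) by (auto intro: eq)
  then have "card {i..i + k} \<le> card {j. j < length xs \<and> xs ! i = xs ! j}"
    by (intro card_mono) auto
  then show False
    using assms(3) by (simp add: count_list_eq_length_filter length_filter_conv_card)
qed

text \<open>Treats end points and interior breakpoints as blocks of one kind, for the lemmas on
  sortedness and multiplicity.\<close>

lemma knots_eq_concat:
  assumes "1 \<le> \<delta>"
  shows "knots p \<delta> x r =
    concat (map (\<lambda>k. replicate (if k = 0 \<or> k = \<delta> then p + 1 else p - r k) (x k)) [0..<Suc \<delta>])"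
proof -
  have "[0..<Suc \<delta>] = 0 # [1..<\<delta>] @ [\<delta>]"
    using assms by (simp add: upt_conv_Cons)
  moreover have "concat (map (\<lambda>k. replicate (p - r k) (x k)) [1..<\<delta>])
      = concat (map (\<lambda>k. replicate (if k = 0 \<or> k = \<delta> then p + 1 else p - r k) (x k)) [1..<\<delta>])"
    by (intro arg_cong[where f = concat] map_cong) auto
  ultimately show ?thesis by (simp add: knots_def)
qed

text \<open>The breakpoints increase strictly, so the list is sorted and no value occurs more than
  \<open>p + 1\<close> times. Hence knots \<open>p + 1\<close> positions apart differ.\<close>

lemma clamped_knots_knots:
  fixes x :: "nat \<Rightarrow> real"
  assumes "1 \<le> \<delta>" and x: "\<forall>k<\<delta>. x k < x (k + 1)" and len: "n + p + 1 = length (knots p \<delta> x r)"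
  shows "clamped_knots (\<lambda>i. if i < n + p + 1 then knots p \<delta> x r ! i else x \<delta>) p n (x 0) (x \<delta>)"
proof -
  let ?K = "knots p \<delta> x r"
  have x_less: "x i < x j" if "i < j" "j \<le> \<delta>" for i j
    using that
  proof (induction j)
    case (Suc j)
    then show ?case using x by (cases "i = j") (auto intro: less_trans)
  qed simp
  then have x_le: "x i \<le> x j" if "i \<le> j" "j \<le> \<delta>" for i j
    using that by (cases "i = j") (auto intro: less_imp_le)
  have sorted: "sorted ?K"
    unfolding knots_eq_concat[OF assms(1)]
    by (intro sorted_concat_replicate) (auto simp: sorted_map sorted_wrt_iff_nth_less intro!: x_le simp del: upt_Suc)
  have inj: "inj_on x (set [0..<Suc \<delta>])"
    by (rule linorder_inj_onI) (use x_less in force)+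
  have count: "count_list ?K v \<le> p + 1" for v
    unfolding knots_eq_concat[OF assms(1)]
    by (intro count_list_concat_replicate_le inj) auto
  have K_le: "?K ! i \<le> x \<delta>" if "i < n + p + 1" for i
  proof -
    have "?K ! i \<in> set ?K" using that len by simp
    also have "set ?K \<subseteq> x ` {..\<delta>}"
      unfolding knots_eq_concat[OF assms(1)] by (auto simp del: upt_Suc)
    finally show ?thesis by (auto intro: x_le)
  qed
  \<comment> \<open>All knots except the final copies of \<open>x \<delta>\<close>. There are
    \<open>n\<close> of them, the first \<open>p + 1\<close> being copies of
    \<open>x 0\<close>.\<close>
  define L where "L = replicate (p + 1) (x 0) @ concat (map (\<lambda>k. replicate (p - r k) (x k)) [1..<\<delta>])"
  have K: "?K = L @ replicate (p + 1) (x \<delta>)" by (simp add: knots_def L_def)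
  then have L: "length L = n" using len by simp
  show ?thesis
  proof
    show "mono (\<lambda>i. if i < n + p + 1 then ?K ! i else x \<delta>)"
      using sorted_nth_mono[OF sorted] len K_le by (intro monoI) auto
    show "(if i < n + p + 1 then ?K ! i else x \<delta>) = x 0" if "i \<le> p" for i
      using that by (simp add: knots_def nth_append del: replicate_Suc)
    show "(if i < n + p + 1 then ?K ! i else x \<delta>) = x \<delta>" if "n \<le> i" for i
      using that L by (auto simp add: K nth_append simp del: replicate_Suc)
    show "(if i < n + p + 1 then ?K ! i else x \<delta>)
        < (if i + p + 1 < n + p + 1 then ?K ! (i + p + 1) else x \<delta>)" if "i < n" for i
      using that sorted_nth_less[OF sorted, of i "p + 1"] len count by simp
    show "p < n" using L by (simp add: L_def)
  qed
qed

text \<open>For \<open>i < n\<close> only entries inside the knot list are read, so the list can be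
  replaced by its monotone extension.\<close>

lemma bspline_cong:
  "(\<And>j. i \<le> j \<Longrightarrow> j \<le> i + q + 1 \<Longrightarrow> t j = t' j) \<Longrightarrow> bspline t b q i = bspline t' b q i"
proof (induction q arbitrary: i)
  case 0
  then show ?case by (simp add: fun_eq_iff)
next
  case (Suc q)
  have "bspline t b q i = bspline t' b q i" "bspline t b q (i + 1) = bspline t' b q (i + 1)"
    by (rule Suc.IH, simp add: Suc.prems)+
  then show ?case using Suc.prems by (simp add: fun_eq_iff)
qed

section \<open>Positive definite matrices\<close>

text \<open>Takes coefficient functions instead of vectors, to match the sums that define
  splines.\<close>

definition bilin :: "nat \<Rightarrow> real mat \<Rightarrow> (nat \<Rightarrow> real) \<Rightarrow> (nat \<Rightarrow> real) \<Rightarrow> real" where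
  "bilin n A c d = (\<Sum>i<n. \<Sum>j<n. c i * A $$ (i, j) * d j)"

lemma bilin_alt: "bilin n A c d = (\<Sum>i<n. c i * (\<Sum>j<n. A $$ (i, j) * d j))"
  by (simp add: bilin_def sum_distrib_left mult.assoc)

lemma bilin_lincomb_left:
  "bilin n A (\<lambda>i. \<alpha> * c i + \<beta> * d i) e = \<alpha> * bilin n A c e + \<beta> * bilin n A d e"
  by (simp add: bilin_alt sum.distrib sum_distrib_left algebra_simps)

lemma bilin_lincomb_right:
  "bilin n A e (\<lambda>i. \<alpha> * c i + \<beta> * d i) = \<alpha> * bilin n A e c + \<beta> * bilin n A e d"
  by (simp add: bilin_def sum.distrib sum_distrib_left algebra_simps)

lemma bilin_sym:
  assumes "\<forall>i<n. \<forall>j<n. A $$ (i, j) = A $$ (j, i)"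
  shows "bilin n A c d = bilin n A d c"
proof -
  have "bilin n A c d = (\<Sum>j<n. \<Sum>i<n. c i * A $$ (i, j) * d j)"
    unfolding bilin_def by (rule sum.swap)
  also have "\<dots> = bilin n A d c"
    unfolding bilin_def using assms by (intro sum.cong) auto
  finally show ?thesis .
qed

lemma bilin_cong:
  "(\<And>i. i < n \<Longrightarrow> c i = c' i) \<Longrightarrow> (\<And>i. i < n \<Longrightarrow> d i = d' i) \<Longrightarrow> bilin n A c d = bilin n A c' d'"
  by (simp add: bilin_def)

lemma scalar_prod_mult_mat_vec:
  assumes "A \<in> carrier_mat n n" "v \<in> carrier_vec n" "w \<in> carrier_vec n"
  shows "scalar_prod v (A *\<^sub>v w) = bilin n A (vec_index v) (vec_index w)"
  using assms by (auto simp: bilin_alt scalar_prod_def row_def atLeast0LessThan intro!: sum.cong)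

lemma spd_mats_iff:
  "A \<in> spd_mats n \<longleftrightarrow> A \<in> carrier_mat n n \<and> (\<forall>i<n. \<forall>j<n. A $$ (i, j) = A $$ (j, i))
    \<and> (\<forall>c. (\<exists>i<n. c i \<noteq> 0) \<longrightarrow> 0 < bilin n A c c)"
proof (cases "A \<in> carrier_mat n n")
  case True
  have "transpose_mat A = A \<longleftrightarrow> (\<forall>i<n. \<forall>j<n. A $$ (i, j) = A $$ (j, i))"
    using True by (auto simp: mat_eq_iff)
  moreover have "(\<forall>v\<in>carrier_vec n. v \<noteq> 0\<^sub>v n \<longrightarrow> 0 < scalar_prod v (A *\<^sub>v v))
    \<longleftrightarrow> (\<forall>c. (\<exists>i<n. c i \<noteq> 0) \<longrightarrow> 0 < bilin n A c c)"
  proof (intro iffI allI ballI impI)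
    fix c :: "nat \<Rightarrow> real"
    assume *: "\<forall>v\<in>carrier_vec n. v \<noteq> 0\<^sub>v n \<longrightarrow> 0 < scalar_prod v (A *\<^sub>v v)" and "\<exists>i<n. c i \<noteq> 0"
    then obtain i where "i < n" "c i \<noteq> 0" by blast
    then have "Matrix.vec n c \<noteq> 0\<^sub>v n" by (metis index_vec index_zero_vec(1))
    then have "0 < bilin n A (vec_index (Matrix.vec n c)) (vec_index (Matrix.vec n c))"
      using * scalar_prod_mult_mat_vec[OF True] by (metis vec_carrier)
    also have "\<dots> = bilin n A c c" by (rule bilin_cong) auto
    finally show "0 < bilin n A c c" .
  next
    fix v :: "real vec"
    assume *: "\<forall>c. (\<exists>i<n. c i \<noteq> 0) \<longrightarrow> 0 < bilin n A c c" and v: "v \<in> carrier_vec n" "v \<noteq> 0\<^sub>v n"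
    then have "\<exists>i<n. vec_index v i \<noteq> 0" by (auto simp: vec_eq_iff)
    then show "0 < scalar_prod v (A *\<^sub>v v)"
      using * scalar_prod_mult_mat_vec[OF True v(1) v(1)] by simp
  qed
  ultimately show ?thesis using True by (simp add: spd_mats_def)
qed (simp add: spd_mats_def)

lemma spd_matsD:
  assumes "A \<in> spd_mats n"
  shows "A \<in> carrier_mat n n" and "\<forall>i<n. \<forall>j<n. A $$ (i, j) = A $$ (j, i)"
    and "i < n \<Longrightarrow> c i \<noteq> 0 \<Longrightarrow> 0 < bilin n A c c" and "0 \<le> bilin n A c c"
proof -
  show "A \<in> carrier_mat n n" "\<forall>i<n. \<forall>j<n. A $$ (i, j) = A $$ (j, i)"
    "i < n \<Longrightarrow> c i \<noteq> 0 \<Longrightarrow> 0 < bilin n A c c"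
    using assms by (auto simp: spd_mats_iff)
  show "0 \<le> bilin n A c c"
  proof (cases "\<exists>i<n. c i \<noteq> 0")
    case True
    then show ?thesis using assms by (auto simp: spd_mats_iff intro: less_imp_le)
  qed (simp add: bilin_def)
qed

text \<open>Positive definiteness excludes a nonzero kernel vector, so the determinant is nonzero
  and the \<open>the\<close> in \<open>inv_mat\<close> is applied to \<open>Some\<close>.\<close>

lemma spd_inverts:
  assumes A: "A \<in> spd_mats n"
  shows "inv_mat A \<in> carrier_mat n n" and "A * inv_mat A = 1\<^sub>m n" and "inv_mat A * A = 1\<^sub>m n"
proof -
  have carr: "A \<in> carrier_mat n n" using A by (simp add: spd_mats_def)
  have "Determinant.det A \<noteq> 0"
  proof
    assume "Determinant.det A = 0"
    then obtain v where v: "v \<in> carrier_vec n" "v \<noteq> 0\<^sub>v n" "A *\<^sub>v v = 0\<^sub>v n"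
      using det_0_iff_vec_prod_zero[OF carr] by blast
    then have "0 < scalar_prod v (0\<^sub>v n)" using A by (auto simp: spd_mats_def)
    then show False using v(1) by simp
  qed
  then have "A \<in> Units (ring_mat TYPE(real) n ())" by (rule det_non_zero_imp_unit[OF carr])
  then have "mat_inverse A \<noteq> None"
    using mat_inverse(1)[OF carr, of "()"] by blast
  then obtain X where "mat_inverse A = Some X" by blast
  then show "inv_mat A \<in> carrier_mat n n" "A * inv_mat A = 1\<^sub>m n" "inv_mat A * A = 1\<^sub>m n"
    using mat_inverse(2)[OF carr] by (auto simp: inv_mat_def)
qed

text \<open>Symmetry follows from uniqueness of inverses. With
  \<open>w = inv_mat A *\<^sub>v v\<close>, the form of the inverse at \<open>v\<close> is the form
  of \<open>A\<close> at \<open>w\<close>.\<close>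

lemma spd_inv_mat:
  assumes A: "A \<in> spd_mats n"
  shows "inv_mat A \<in> spd_mats n"
proof -
  let ?X = "inv_mat A"
  note X = spd_inverts[OF A]
  have carr: "A \<in> carrier_mat n n" and sym: "transpose_mat A = A" using A by (auto simp: spd_mats_def)
  have "transpose_mat ?X * A = transpose_mat (A * ?X)"
    using transpose_mult[OF carr X(1)] sym by simp
  also have "\<dots> = 1\<^sub>m n" by (simp add: X(2))
  finally have XA: "transpose_mat ?X * A = 1\<^sub>m n" .
  have "transpose_mat ?X = transpose_mat ?X * (A * ?X)"
    using X by simp
  also have "\<dots> = (transpose_mat ?X * A) * ?X"
    using assoc_mult_mat[OF _ carr X(1), of "transpose_mat ?X" n] X(1) by simp
  also have "\<dots> = ?X" using XA X(1) by simp
  finally have "transpose_mat ?X = ?X" .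
  moreover have "0 < scalar_prod v (?X *\<^sub>v v)" if v: "v \<in> carrier_vec n" "v \<noteq> 0\<^sub>v n" for v
  proof -
    define w where "w = ?X *\<^sub>v v"
    have w: "w \<in> carrier_vec n" using X(1) v by (simp add: w_def)
    have "A *\<^sub>v w = (A * ?X) *\<^sub>v v"
      unfolding w_def using assoc_mult_mat_vec[OF carr X(1) v(1)] by simp
    then have Aw: "A *\<^sub>v w = v" using X(2) v by simp
    then have "w \<noteq> 0\<^sub>v n" using v carr by auto
    then have "0 < scalar_prod w (A *\<^sub>v w)" using A w by (auto simp: spd_mats_def)
    then show ?thesis using Aw w v comm_scalar_prod[OF w v(1)] by (simp add: w_def)
  qed
  ultimately show ?thesis using X(1) by (simp add: spd_mats_def)
qed

text \<open>The form of the submatrix is that of \<open>A\<close> restricted to coefficients with a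
  0 in front.\<close>

lemma spd_mat_delete:
  assumes A: "A \<in> spd_mats (Suc k)"
  shows "mat_delete A 0 0 \<in> spd_mats k"
    and "i < k \<Longrightarrow> j < k \<Longrightarrow> mat_delete A 0 0 $$ (i, j) = A $$ (Suc i, Suc j)"
proof -
  note * = spd_matsD[OF A]
  show entry: "mat_delete A 0 0 $$ (i, j) = A $$ (Suc i, Suc j)" if "i < k" "j < k" for i j
    using *(1) that by (simp add: mat_delete_def)
  have "0 < bilin k (mat_delete A 0 0) c c" if "\<exists>i<k. c i \<noteq> 0" for c
  proof -
    obtain i where i: "i < k" "c i \<noteq> 0" using \<open>\<exists>i<k. c i \<noteq> 0\<close> by blast
    let ?c = "case_nat 0 c"
    have "0 < bilin (Suc k) A ?c ?c" using *(3)[of "Suc i" ?c] i by simp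
    also have "\<dots> = bilin k (mat_delete A 0 0) c c"
      by (simp add: bilin_def sum.lessThan_Suc_shift entry del: sum.lessThan_Suc)
    finally show ?thesis .
  qed
  then show "mat_delete A 0 0 \<in> spd_mats k"
    using * entry by (auto simp: spd_mats_iff mat_delete_def)
qed

section \<open>Linear systems and the quadratic objective\<close>

lemma mat_inverse_sums:
  fixes A X :: "real mat"
  assumes "X * A = 1\<^sub>m n" and "X \<in> carrier_mat n n" and "A \<in> carrier_mat n n" and "i < n"
  shows "(\<Sum>j<n. X $$ (i, j) * (\<Sum>k<n. A $$ (j, k) * \<gamma> k)) = \<gamma> i"
proof -
  have "(\<Sum>j<n. X $$ (i, j) * (\<Sum>k<n. A $$ (j, k) * \<gamma> k)) = (\<Sum>k<n. (\<Sum>j<n. X $$ (i, j) * A $$ (j, k)) * \<gamma> k)"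
    by (simp add: sum_distrib_left sum_distrib_right mult.assoc) (rule sum.swap)
  also have "\<dots> = (\<Sum>k<n. if k = i then \<gamma> k else 0)"
  proof (rule sum.cong)
    fix k assume "k \<in> {..<n}"
    then have "(\<Sum>j<n. X $$ (i, j) * A $$ (j, k)) = (X * A) $$ (i, k)"
      using assms(2-4) by (auto simp: scalar_prod_def atLeast0LessThan intro!: sum.cong)
    then show "(\<Sum>j<n. X $$ (i, j) * A $$ (j, k)) * \<gamma> k = (if k = i then \<gamma> k else 0)"
      using assms(1,4) \<open>k \<in> {..<n}\<close> by simp
  qed simp
  also have "\<dots> = \<gamma> i" using assms(4) by simp
  finally show ?thesis .
qed

text \<open>Row 0 of \<open>A d = \<beta>\<close> may fail, as it carries the multiplier of the
  constraint. Testing against \<open>e\<close> with \<open>e 0 = 0\<close> removes this row and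
  turns both linear terms into values of the form; the rest is completing the square.\<close>

lemma quadratic_min_identity:
  fixes A :: "real mat"
  assumes sym: "\<forall>i<n. \<forall>j<n. A $$ (i, j) = A $$ (j, i)"
    and stat: "\<And>i. 0 < i \<Longrightarrow> i < n \<Longrightarrow> (\<Sum>j<n. A $$ (i, j) * d j) = \<beta> i"
    and "d 0 = 0" and "c 0 = 0"
  shows "1 / 2 * bilin n A c c - (\<Sum>i<n. c i * \<beta> i)
    = 1 / 2 * bilin n A d d - (\<Sum>i<n. d i * \<beta> i)
      + 1 / 2 * bilin n A (\<lambda>i. c i - d i) (\<lambda>i. c i - d i)"
proof -
  have *: "bilin n A e d = (\<Sum>i<n. e i * \<beta> i)" if "e 0 = 0" for e
    unfolding bilin_alt
  proof (rule sum.cong)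
    fix i assume "i \<in> {..<n}"
    then show "e i * (\<Sum>j<n. A $$ (i, j) * d j) = e i * \<beta> i"
      using that stat[of i] by (cases "i = 0") auto
  qed simp
  have "bilin n A (\<lambda>i. c i - d i) (\<lambda>i. c i - d i) = bilin n A c c - 2 * bilin n A c d + bilin n A d d"
    using bilin_lincomb_left[of n A 1 c "-1" d] bilin_lincomb_right[of n A _ 1 c "-1" d] bilin_sym[OF sym, of d c]
    by simp
  then show ?thesis using *[of c] *[of d] assms by (simp add: field_simps)
qed

text \<open>The gap between the two sides is \<open>(1 - s) * s\<close> times the form at
  \<open>c - d\<close>.\<close>

lemma bilin_convex:
  assumes A: "A \<in> spd_mats n" and "0 \<le> s" "s \<le> 1"
  shows "bilin n A (\<lambda>i. (1 - s) * c i + s * d i) (\<lambda>i. (1 - s) * c i + s * d i)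
    \<le> (1 - s) * bilin n A c c + s * bilin n A d d"
proof -
  note sym = bilin_sym[OF spd_matsD(2)[OF A], of d c]
  have "bilin n A (\<lambda>i. c i - d i) (\<lambda>i. c i - d i) = bilin n A c c - 2 * bilin n A c d + bilin n A d d"
    using bilin_lincomb_left[of n A 1 c "-1" d] bilin_lincomb_right[of n A _ 1 c "-1" d] sym by simp
  moreover have "bilin n A (\<lambda>i. (1 - s) * c i + s * d i) (\<lambda>i. (1 - s) * c i + s * d i)
      = (1 - s)\<^sup>2 * bilin n A c c + 2 * s * (1 - s) * bilin n A c d + s\<^sup>2 * bilin n A d d"
    unfolding bilin_lincomb_left bilin_lincomb_right sym by (simp add: power2_eq_square algebra_simps)
  ultimately have "(1 - s) * bilin n A c c + s * bilin n A d d
     - bilin n A (\<lambda>i. (1 - s) * c i + s * d i) (\<lambda>i. (1 - s) * c i + s * d i)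
    = (1 - s) * s * bilin n A (\<lambda>i. c i - d i) (\<lambda>i. c i - d i)"
    by (simp only:) (simp add: power2_eq_square algebra_simps)
  moreover have "0 \<le> (1 - s) * s * bilin n A (\<lambda>i. c i - d i) (\<lambda>i. c i - d i)"
    using assms spd_matsD(4)[OF A] by simp
  ultimately show ?thesis by linarith
qed

section \<open>Splines in the space of square integrable functions\<close>

lemma borel_measurable_lebesgue_onI: "h \<in> borel_measurable borel \<Longrightarrow> h \<in> borel_measurable (lebesgue_on X)"
  by (intro measurable_restrict_space1 measurable_completion) simp

lemma integrable_const_lebesgue_on_interval: "integrable (lebesgue_on {a..b::real}) (\<lambda>y. c::real)"
  by (intro finite_measure.integrable_const finite_measure_lebesgue_on) simp

text \<open>Since \<open>\<bar>f y\<bar> \<le> 1 + (f y)\<^sup>2\<close>, the product is dominated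
  by \<open>C * (1 + (f y)\<^sup>2)\<close>, which is integrable on a bounded interval.\<close>

lemma integrable_bounded_mult_L2:
  assumes h: "h \<in> borel_measurable borel" "\<forall>y\<in>{a..b}. \<bar>h y\<bar> \<le> C" and f: "f \<in> L2_space a b"
  shows "integrable (lebesgue_on {a..b}) (\<lambda>y. h y * f y)"
proof (rule Bochner_Integration.integrable_bound)
  show "integrable (lebesgue_on {a..b}) (\<lambda>y. C * (1 + (f y)\<^sup>2))"
    using f by (intro integrable_mult_right Bochner_Integration.integrable_add
        integrable_const_lebesgue_on_interval) (simp add: L2_space_def)
  show "(\<lambda>y. h y * f y) \<in> borel_measurable (lebesgue_on {a..b})"
    using borel_measurable_lebesgue_onI[OF h(1)] f by (intro borel_measurable_times) (simp_all add: L2_space_def)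
  have "\<bar>h y * f y\<bar> \<le> \<bar>C * (1 + (f y)\<^sup>2)\<bar>" if "y \<in> {a..b}" for y
  proof -
    have "\<bar>f y\<bar> \<le> 1 + (f y)\<^sup>2"
      using zero_le_power2[of "\<bar>f y\<bar> - 1"] by (simp add: power2_eq_square algebra_simps)
    then have "\<bar>h y * f y\<bar> \<le> C * (1 + (f y)\<^sup>2)"
      unfolding abs_mult using h(2) that by (intro mult_mono) (auto intro: order.trans[OF abs_ge_zero])
    then show ?thesis by linarith
  qed
  then show "AE y in lebesgue_on {a..b}. norm (h y * f y) \<le> norm (C * (1 + (f y)\<^sup>2))"
    by (intro AE_I2) simp
qed

lemma bounded_in_L2_space:
  assumes "h \<in> borel_measurable borel" and "\<forall>y\<in>{a..b}. \<bar>h y\<bar> \<le> C"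
  shows "h \<in> L2_space a b"
proof -
  have "(\<lambda>y. 1) \<in> L2_space a b"
    by (simp add: L2_space_def integrable_const_lebesgue_on_interval)
  moreover have "(\<lambda>y. (h y)\<^sup>2) \<in> borel_measurable borel" using assms(1) by simp
  moreover have "\<forall>y\<in>{a..b}. \<bar>(h y)\<^sup>2\<bar> \<le> C\<^sup>2"
    using assms(2) by (auto simp: abs_le_square_iff[symmetric] intro: order.trans[OF _ abs_ge_self])
  ultimately have "integrable (lebesgue_on {a..b}) (\<lambda>y. (h y)\<^sup>2 * 1)"
    by (intro integrable_bounded_mult_L2)
  then show ?thesis
    using borel_measurable_lebesgue_onI[OF assms(1)] by (simp add: L2_space_def)
qed

lemma L2_inner_commute: "L2_inner a b f g = L2_inner a b g f"
  by (simp add: L2_inner_def mult.commute)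

lemma L2_inner_cong:
  "(\<And>y. y \<in> {a..b} \<Longrightarrow> f y = f' y) \<Longrightarrow> L2_inner a b f g = L2_inner a b f' g"
  unfolding L2_inner_def by (intro Bochner_Integration.integral_cong) auto

text \<open>Agreement is required for \<open>i < n\<close> only: a family read off a knot list meets
  unspecified entries at larger indices.\<close>

locale spline_basis = clamped_knots +
  fixes B :: "nat \<Rightarrow> real \<Rightarrow> real"
  assumes B_eq: "i < n \<Longrightarrow> B i = bspline t b p i"
begin

abbreviation spline :: "(nat \<Rightarrow> real) \<Rightarrow> real \<Rightarrow> real" where
  "spline c \<equiv> (\<lambda>y. \<Sum>i<n. c i * B i y)"

lemma spline_eq: "spline c y = (\<Sum>i<n. c i * bspline t b p i y)"
  by (intro sum.cong) (simp_all add: B_eq)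

lemma spline_coeffs_unique:
  assumes "\<And>y. y \<in> {a..b} \<Longrightarrow> spline c y = spline d y" and "i < n"
  shows "c i = d i"
  using coeffs_unique[of c d i] assms unfolding spline_eq by blast

lemma spline_left_end: "spline c a = c 0"
proof -
  have "spline c a = (\<Sum>i<n. if i = 0 then c 0 else 0)"
    unfolding spline_eq by (intro sum.cong) (auto simp: bspline_at_left_end)
  then show ?thesis using degree_less by simp
qed

lemma spline_measurable: "spline c \<in> borel_measurable borel"
  unfolding spline_eq by measurable

lemma spline_bounded: "\<exists>C. \<forall>y\<in>{a..b}. \<bar>spline c y\<bar> \<le> C"
proof -
  obtain C where C: "\<And>i y. y \<in> {a..b} \<Longrightarrow> \<bar>bspline t b p i y\<bar> \<le> C i"
    using bspline_bounded[of a b t b p] by metis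
  have "\<bar>spline c y\<bar> \<le> (\<Sum>i<n. \<bar>c i\<bar> * C i)" if "y \<in> {a..b}" for y
    unfolding spline_eq using C[OF that]
    by (intro order.trans[OF sum_abs] sum_mono) (auto simp: abs_mult intro: mult_left_mono)
  then show ?thesis by blast
qed

lemma spline_in_L2: "spline c \<in> L2_space a b"
  using spline_bounded[of c] spline_measurable bounded_in_L2_space by blast

lemma L2_inner_spline:
  assumes "f \<in> L2_space a b"
  shows "L2_inner a b (spline c) f = (\<Sum>i<n. c i * L2_inner a b (B i) f)"
proof -
  have int: "integrable (lebesgue_on {a..b}) (\<lambda>y. B i y * f y)" if "i < n" for i
    using bspline_bounded[of a b t b p i] integrable_bounded_mult_L2[OF borel_measurable_bspline _ assms]
    by (auto simp: B_eq[OF that])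
  have "L2_inner a b (spline c) f = (LINT y|lebesgue_on {a..b}. (\<Sum>i<n. c i * (B i y * f y)))"
    by (simp add: L2_inner_def sum_distrib_right mult.assoc)
  also have "\<dots> = (\<Sum>i<n. LINT y|lebesgue_on {a..b}. c i * (B i y * f y))"
    by (intro Bochner_Integration.integral_sum integrable_mult_right int) simp
  also have "\<dots> = (\<Sum>i<n. c i * L2_inner a b (B i) f)"
    by (simp add: L2_inner_def)
  finally show ?thesis .
qed

lemma B_in_L2: "i < n \<Longrightarrow> B i \<in> L2_space a b"
  using bspline_bounded[of a b t b p i] bounded_in_L2_space[OF borel_measurable_bspline]
  by (auto simp: B_eq)

section \<open>The Gram matrix and B-spline coordinates\<close>

abbreviation "G \<equiv> gram_mat a b n B"

lemma L2_inner_spline_B: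
  assumes "i < n"
  shows "L2_inner a b (spline c) (B i) = (\<Sum>j<n. G $$ (i, j) * c j)"
  using assms
  by (auto simp: L2_inner_spline[OF B_in_L2] gram_mat_def L2_inner_commute[of a b "B i"] mult.commute intro!: sum.cong)

lemma L2_inner_splines: "L2_inner a b (spline c) (spline d) = bilin n G c d"
proof -
  have "L2_inner a b (spline c) (spline d) = (\<Sum>i<n. c i * L2_inner a b (spline d) (B i))"
    by (simp add: L2_inner_spline[OF spline_in_L2] L2_inner_commute)
  then show ?thesis by (simp add: L2_inner_spline_B bilin_alt)
qed

text \<open>A spline of norm 0 vanishes almost everywhere, but a nonzero coefficient makes it
  nonzero on an open interval, which is not a null set.\<close>

lemma L2_inner_spline_pos:
  assumes "i < n" and "c i \<noteq> 0"
  shows "0 < L2_inner a b (spline c) (spline c)"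
proof -
  let ?M = "lebesgue_on {a..b}"
  have int: "integrable ?M (\<lambda>y. (spline c y)\<^sup>2)"
    using spline_in_L2 by (simp add: L2_space_def)
  have eq: "L2_inner a b (spline c) (spline c) = (LINT y|?M. (spline c y)\<^sup>2)"
    by (simp add: L2_inner_def power2_eq_square)
  have "(LINT y|?M. (spline c y)\<^sup>2) \<noteq> 0"
  proof
    assume "(LINT y|?M. (spline c y)\<^sup>2) = 0"
    then have "AE y in ?M. spline c y = 0"
      using integral_nonneg_eq_0_iff_AE[OF int] by simp
    then have AE: "AE y in lebesgue. y \<in> {a..b} \<longrightarrow> spline c y = 0"
      by (subst (asm) AE_restrict_space_iff) auto
    obtain \<alpha> \<beta> where *: "a \<le> \<alpha>" "\<alpha> < \<beta>" "\<beta> \<le> b" "\<forall>y\<in>{\<alpha><..<\<beta>}. spline c y \<noteq> 0"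
      using ex_spline_nonzero_interval[of i c] assms unfolding spline_eq by blast
    have "AE y in lebesgue. y \<notin> {\<alpha><..<\<beta>}"
      using AE by eventually_elim (use * in force)
    then have "{\<alpha><..<\<beta>} \<in> null_sets lebesgue"
      using AE_iff_null_sets[of "{\<alpha><..<\<beta>}" lebesgue] by simp
    then show False using *(2) by (auto simp: null_sets_def)
  qed
  moreover have "0 \<le> (LINT y|?M. (spline c y)\<^sup>2)" by (intro integral_nonneg_AE) simp
  ultimately show ?thesis unfolding eq by linarith
qed

lemma gram_mat_spd: "G \<in> spd_mats n"
  unfolding spd_mats_iff
proof (intro conjI allI impI)
  show "G \<in> carrier_mat n n" by (simp add: gram_mat_def)
  show "G $$ (i, j) = G $$ (j, i)" if "i < n" "j < n" for i j
    using that by (simp add: gram_mat_def L2_inner_commute)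
  show "0 < bilin n G c c" if "\<exists>i<n. c i \<noteq> 0" for c
    using that L2_inner_spline_pos unfolding L2_inner_splines by blast
qed

text \<open>Linear independence on \<open>{a..b}\<close> makes the definite description in
  \<open>coords\<close> well defined.\<close>

lemma coords_spline: "coords n B (spline c) = Matrix.vec n c"
  unfolding coords_def
proof (rule the_equality)
  show "Matrix.vec n c \<in> carrier_vec n \<and> spline c = spline (vec_index (Matrix.vec n c))"
    by (auto intro!: sum.cong)
next
  fix v assume v: "v \<in> carrier_vec n \<and> spline c = spline (vec_index v)"
  then have "c i = vec_index v i" if "i < n" for i
    using spline_coeffs_unique[OF _ that] by metis
  then show "v = Matrix.vec n c" using v by (auto simp: vec_eq_iff)
qed

lemma discrete_inner_spline: "discrete_inner n B A (spline c) (spline d) = bilin n A c d"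
  unfolding discrete_inner_def coords_spline bilin_def by (intro sum.cong) auto

text \<open>The true dual basis recovers coefficients, since the inverse of \<open>G\<close> undoes
  \<open>G\<close>. On polynomials, \<open>S\<close> gives the same inner products.\<close>

lemma approx_dual_reproduces:
  assumes S: "approx_dual_mat a b p n B S" and g: "g \<in> poly_space p a b"
    and gc: "\<And>y. y \<in> {a..b} \<Longrightarrow> g y = spline c y" and "i < n"
  shows "(\<Sum>j<n. S $$ (i, j) * L2_inner a b (spline c) (B j)) = c i"
proof -
  have *: "L2_inner a b g (spline d) = (\<Sum>j<n. d j * L2_inner a b (spline c) (B j))" for d
  proof -
    have "L2_inner a b g (spline d) = L2_inner a b (spline c) (spline d)"
      by (rule L2_inner_cong) (rule gc)
    also have "\<dots> = L2_inner a b (spline d) (spline c)"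
      by (rule L2_inner_commute)
    also have "\<dots> = (\<Sum>j<n. d j * L2_inner a b (B j) (spline c))"
      by (rule L2_inner_spline[OF spline_in_L2])
    also have "\<dots> = (\<Sum>j<n. d j * L2_inner a b (spline c) (B j))"
      by (simp only: L2_inner_commute[of a b "spline c"])
    finally show ?thesis .
  qed
  have "L2_inner a b g (mat_comb n S B i) = L2_inner a b g (dual_basis a b n B i)"
    using S g \<open>i < n\<close> by (simp add: approx_dual_mat_def)
  then have "(\<Sum>j<n. S $$ (i, j) * L2_inner a b (spline c) (B j))
      = (\<Sum>j<n. inv_mat G $$ (i, j) * L2_inner a b (spline c) (B j))"
    by (simp only: mat_comb_def[abs_def] dual_basis_def *)
  also have "\<dots> = (\<Sum>j<n. inv_mat G $$ (i, j) * (\<Sum>k<n. G $$ (j, k) * c k))"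
    by (simp add: L2_inner_spline_B)
  also have "\<dots> = c i"
    using spd_inverts[OF gram_mat_spd] gram_mat_spd \<open>i < n\<close>
    by (intro mat_inverse_sums) (auto simp: spd_mats_def)
  finally show ?thesis .
qed

section \<open>The constrained minimization problem\<close>

text \<open>A leading coefficient 0 makes the function a spline in the full basis, so that
  \<open>L2_inner_spline\<close> applies.\<close>

lemma constrained_dual_eq_spline:
  assumes "n = Suc k"
  shows "constrained_dual n B A (Suc i)
    = spline (case_nat 0 (\<lambda>j. inv_mat (mat_delete A 0 0) $$ (i, j)))"
  using assms
  by (simp add: constrained_dual_def mat_comb_def fun_eq_iff sum.lessThan_Suc_shift del: sum.lessThan_Suc)

text \<open>By \<open>d_Suc\<close>, the coefficients \<open>d 1, ..., d k\<close> are the inverse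
  of the submatrix applied to the corresponding inner products with \<open>f\<close>. Since
  \<open>d 0 = 0\<close>, row \<open>i\<close> of \<open>A\<close> acts on \<open>d\<close> as row
  \<open>i - 1\<close> of the submatrix.\<close>

lemma constrained_dual_stationary:
  assumes A: "A \<in> spd_mats n" and f: "f \<in> L2_space a b" and "0 < i" "i < n"
    and d: "d = (\<lambda>i. if i = 0 then 0 else L2_inner a b f (constrained_dual n B A i))"
  shows "(\<Sum>j<n. A $$ (i, j) * d j) = L2_inner a b (B i) f"
proof -
  obtain k where n: "n = Suc k" using degree_less by (cases n) auto
  obtain l where l: "i = Suc l" "l < k" using assms(3,4) n by (cases i) auto
  let ?H = "mat_delete A 0 0"
  note H = spd_mat_delete[OF A[unfolded n]]
  have d_Suc: "d (Suc j) = (\<Sum>m<k. inv_mat ?H $$ (j, m) * L2_inner a b (B (Suc m)) f)" for j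
  proof -
    have "d (Suc j) = L2_inner a b (spline (case_nat 0 (\<lambda>m. inv_mat ?H $$ (j, m)))) f"
      unfolding d by (simp add: constrained_dual_eq_spline[OF n] L2_inner_commute[of a b f])
    also have "\<dots> = (\<Sum>m<n. case_nat 0 (\<lambda>m. inv_mat ?H $$ (j, m)) m * L2_inner a b (B m) f)"
      by (rule L2_inner_spline[OF f])
    also have "\<dots> = (\<Sum>m<k. inv_mat ?H $$ (j, m) * L2_inner a b (B (Suc m)) f)"
      unfolding n by (simp add: sum.lessThan_Suc_shift del: sum.lessThan_Suc)
    finally show ?thesis .
  qed
  have "(\<Sum>j<n. A $$ (i, j) * d j) = (\<Sum>j<k. ?H $$ (l, j) * d (Suc j))"
    unfolding n using l H(2) by (simp add: sum.lessThan_Suc_shift d del: sum.lessThan_Suc)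
  also have "\<dots> = L2_inner a b (B (Suc l)) f"
    unfolding d_Suc using spd_inverts[OF H(1)] spd_matsD(1)[OF H(1)] l(2)
    by (intro mat_inverse_sums)
  finally show ?thesis using l by simp
qed

end

theorem theorem3p5:
  fixes p \<delta> n :: nat and x :: "nat \<Rightarrow> real" and r :: "nat \<Rightarrow> nat"
    and a b :: real and B :: "nat \<Rightarrow> real \<Rightarrow> real"
    and S Ghat :: "real mat" and f F u :: "real \<Rightarrow> real"
    and J :: "(real \<Rightarrow> real) \<Rightarrow> real" and feasible :: "(real \<Rightarrow> real) \<Rightarrow> bool"
  assumes "1 \<le> \<delta>" and "\<forall>k<\<delta>. x k < x (k + 1)"
    and "\<forall>k\<in>{1..<\<delta>}. r k < p"
    and "a = x 0" and "b = x \<delta>"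
    and "n + p + 1 = length (knots p \<delta> x r)"
    and "B = bspline (\<lambda>i. knots p \<delta> x r ! i) b p"
    and "approx_dual_mat a b p n B S"
    and "Ghat = inv_mat S"
    and "f \<in> H1_space a b" and "continuous_representative a b f F" and "F a = 0"
    and "u = (\<lambda>y. \<Sum>i=1..<n. L2_inner a b f (constrained_dual n B Ghat i) * B i y)"
    and "J = (\<lambda>v. 1 / 2 * discrete_inner n B Ghat v v - L2_inner a b v f)"
    and "feasible = (\<lambda>v. v \<in> spline_space n B \<and> v a = 0)"
  shows "convex_problem J feasible
    \<and> (\<forall>v. is_arg_min J feasible v \<longleftrightarrow> v = u)
    \<and> (F \<in> poly_space p a b \<longrightarrow> (\<forall>y\<in>{a..b}. u y = F y))"
proof -
  \<comment> \<open>\<open>xs ! i\<close> is unspecified past the end of the list; the extension by \<open>b\<close> keeps the knots monotone.\<close>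
  define t where "t i = (if i < n + p + 1 then knots p \<delta> x r ! i else x \<delta>)" for i
  interpret clamped_knots t p n a b
    using clamped_knots_knots[OF assms(1,2,6)] assms(4,5) by (simp add: t_def[abs_def])
  interpret spline_basis t p n a b B
  proof
    show "B i = bspline t b p i" if "i < n" for i
      unfolding assms(7) by (rule bspline_cong) (use that in \<open>simp add: t_def\<close>)
  qed
  have f: "f \<in> L2_space a b" using assms(10) by (simp add: H1_space_def)
  have S: "S \<in> spd_mats n" using assms(8) by (simp add: approx_dual_mat_def)
  then have A: "Ghat \<in> spd_mats n" unfolding assms(9) by (rule spd_inv_mat)
  define \<beta> where "\<beta> i = L2_inner a b (B i) f" for i
  define d where "d = (\<lambda>i. if i = 0 then 0 else L2_inner a b f (constrained_dual n B Ghat i))"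
  have stat: "(\<Sum>j<n. Ghat $$ (i, j) * d j) = \<beta> i" if "0 < i" "i < n" for i
    unfolding \<beta>_def using constrained_dual_stationary[OF A f that] by (simp add: d_def)
  have "d 0 = 0" by (simp add: d_def)
  have u: "u = spline d"
  proof
    fix y
    show "u y = spline d y"
      unfolding assms(13) by (intro sum.mono_neutral_cong_left) (auto simp: d_def)
  qed
  have J: "J (spline c) = 1 / 2 * bilin n Ghat c c - (\<Sum>i<n. c i * \<beta> i)" for c
    unfolding assms(14) by (simp add: discrete_inner_spline L2_inner_spline[OF f] \<beta>_def)
  have feasible: "feasible v \<longleftrightarrow> (\<exists>c. v = spline c \<and> c 0 = 0)" for v
    unfolding assms(15) spline_space_def using spline_left_end by auto
  let ?Q = "\<lambda>c d. bilin n Ghat (\<lambda>i. c i - d i) (\<lambda>i. c i - d i)"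
  have J_min: "J (spline c) = J u + 1 / 2 * ?Q c d" if "c 0 = 0" for c
    unfolding u J by (intro quadratic_min_identity spd_matsD(2)[OF A] stat \<open>d 0 = 0\<close> that)
  have Q_pos: "0 < ?Q c e" if "spline c \<noteq> spline e" for c e
  proof -
    have "\<exists>i<n. c i \<noteq> e i"
    proof (rule ccontr)
      assume "\<not> (\<exists>i<n. c i \<noteq> e i)"
      then have "spline c = spline e" by (intro ext sum.cong) auto
      then show False using that by contradiction
    qed
    then show ?thesis using spd_matsD(3)[OF A, of _ "\<lambda>i. c i - e i"] by auto
  qed

  have "convex_problem J feasible"
    unfolding convex_problem_def
  proof (intro allI ballI impI)
    fix v w s assume s: "s \<in> {0..1::real}" and "feasible v" "feasible w"
    then obtain c e where c: "v = spline c" "c 0 = 0" and e: "w = spline e" "e 0 = 0"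
      unfolding feasible by blast
    have vw: "(\<lambda>y. (1 - s) * v y + s * w y) = spline (\<lambda>i. (1 - s) * c i + s * e i)"
      unfolding c e by (simp add: sum.distrib sum_distrib_left sum_subtractf algebra_simps)
    have linear: "(\<Sum>i<n. ((1 - s) * c i + s * e i) * \<beta> i)
        = (1 - s) * (\<Sum>i<n. c i * \<beta> i) + s * (\<Sum>i<n. e i * \<beta> i)"
      by (simp add: sum.distrib sum_distrib_left sum_subtractf algebra_simps)
    have "(1 - s) * J v + s * J w = 1 / 2 * ((1 - s) * bilin n Ghat c c + s * bilin n Ghat e e)
        - ((1 - s) * (\<Sum>i<n. c i * \<beta> i) + s * (\<Sum>i<n. e i * \<beta> i))"
      unfolding c e J by (simp add: field_simps)
    then have "J (spline (\<lambda>i. (1 - s) * c i + s * e i)) \<le> (1 - s) * J v + s * J w"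
      unfolding J linear using bilin_convex[OF A, of s c e] s by simp
    moreover have "feasible (spline (\<lambda>i. (1 - s) * c i + s * e i))"
      unfolding feasible using c(2) e(2) by (intro exI[of _ "\<lambda>i. (1 - s) * c i + s * e i"]) simp
    ultimately show "feasible (\<lambda>y. (1 - s) * v y + s * w y) \<and>
        J (\<lambda>y. (1 - s) * v y + s * w y) \<le> (1 - s) * J v + s * J w"
      unfolding vw by blast
  qed

  moreover have "is_arg_min J feasible v \<longleftrightarrow> v = u" for v
  proof
    have "feasible u" unfolding feasible u using \<open>d 0 = 0\<close> by blast
    moreover have "J u \<le> J w" if "feasible w" for w
    proof -
      obtain c where "w = spline c" "c 0 = 0" using \<open>feasible w\<close> unfolding feasible by blast
      then show ?thesis using J_min[of c] spd_matsD(4)[OF A] by simp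
    qed
    ultimately show "is_arg_min J feasible v" if "v = u"
      using that by (auto simp: is_arg_min_def not_less)
    show "v = u" if v: "is_arg_min J feasible v"
    proof (rule ccontr)
      assume "v \<noteq> u"
      obtain c where c: "v = spline c" "c 0 = 0"
        using v unfolding is_arg_min_def feasible by blast
      then have "J u < J v" using J_min[of c] Q_pos[of c d] \<open>v \<noteq> u\<close> u by simp
      then show False using v \<open>feasible u\<close> by (auto simp: is_arg_min_def)
    qed
  qed

  moreover have "\<forall>y\<in>{a..b}. u y = F y" if F: "F \<in> poly_space p a b"
  proof -
    obtain c where c: "\<And>y. y \<in> {a..b} \<Longrightarrow> F y = spline c y"
      using poly_in_span[OF F] unfolding spline_eq by blast
    have "a \<in> {a..b}" using knots_le_right[of 0] knots_left[of 0] by simp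
    then have "c 0 = 0" using c assms(12) spline_left_end by metis
    \<comment> \<open>The values of \<open>f\<close> agree with those of \<open>spline c\<close>
      almost everywhere only, which is enough for the integrals.\<close>
    have "\<beta> i = L2_inner a b (spline c) (B i)" if "i < n" for i
    proof -
      have "AE y in lebesgue_on {a..b}. f y = F y"
        using assms(11) by (simp add: continuous_representative_def)
      then have "AE y in lebesgue_on {a..b}. B i y * f y = spline c y * B i y"
        using AE_space by eventually_elim (simp add: c)
      moreover have "f \<in> borel_measurable (lebesgue_on {a..b})"
        "B i \<in> borel_measurable (lebesgue_on {a..b})"
        "spline c \<in> borel_measurable (lebesgue_on {a..b})"
        using f B_in_L2[OF that] spline_in_L2[of c] by (simp_all add: L2_space_def)
      ultimately show ?thesis
        unfolding \<beta>_def L2_inner_def by (intro integral_cong_AE borel_measurable_times)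
    qed
    then have "c j = (\<Sum>k<n. S $$ (j, k) * \<beta> k)" if "j < n" for j
      using approx_dual_reproduces[OF assms(8) F c that] by simp
    \<comment> \<open>The coefficients satisfy \<open>c = S \<beta>\<close>; applying
      \<open>Ghat\<close>, the inverse of \<open>S\<close>, gives \<open>\<beta>\<close>
      back.\<close>
    then have "(\<Sum>j<n. Ghat $$ (i, j) * c j) = \<beta> i" if "0 < i" "i < n" for i
      using mat_inverse_sums[OF spd_inverts(3)[OF S] spd_inverts(1)[OF S] spd_matsD(1)[OF S] that(2), of \<beta>]
      by (simp add: assms(9))
    \<comment> \<open>The identity \<open>J_min\<close> with the roles of \<open>c\<close> and
      \<open>d\<close> exchanged. Adding the two shows that the two nonnegative values of the form
      sum to 0.\<close>
    then have "J u = J (spline c) + 1 / 2 * ?Q d c"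
      unfolding u J by (intro quadratic_min_identity spd_matsD(2)[OF A] \<open>c 0 = 0\<close> \<open>d 0 = 0\<close>)
    then have "?Q c d \<le> 0" using J_min[of c, OF \<open>c 0 = 0\<close>] spd_matsD(4)[OF A, of "\<lambda>i. d i - c i"] by simp
    then have "spline c = spline d" using Q_pos[of c d] by linarith
    then show ?thesis using c u by metis
  qed
  ultimately show ?thesis by blast
qed

end
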